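(* Let $K$ be a field, $(A,\circ,\alpha_A,\beta_A)$ a BiHom-pre-Lie algebra, and $M$ a vector space with linear maps $A\otimes M\to M$, $a\otimes m\mapsto a\circ_\ell m$, and $M\otimes A\to M$, $m\otimes a\mapsto m\circ_r a$, and two commuting linear maps $\alpha_M,\beta_M:M\to M$. Define on $A\oplus M$ $$(a+m)\circ_{A\oplus M}(a'+m')=a\circ a'+a\circ_\ell m'+m\circ_r a',\qquad a,a'\in A,\ m,m'\in M.$$ Then $(A\oplus M,\circ_{A\oplus M},\alpha_A\oplus\alpha_M,\beta_A\oplus\beta_M)$ is a BiHom-pre-Lie algebra if and only if $(M,\circ_\ell,\circ_r,\alpha_M,\beta_M)$ is a BiHom-pre-Lie bimodule over $(A,\circ,\alpha_A,\beta_A)$.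
   Context: $(f\oplus g)(a+m)=f(a)+g(m)$. Everything is over the field $K$. (Left) BiHom-pre-Lie algebra $(A,\circ,\alpha,\beta)$: bilinear $\circ$, commuting linear multiplicative $\alpha,\beta$, with $\alpha\beta(a)\circ(\alpha(b)\circ c)-(\beta(a)\circ\alpha(b))\circ\beta(c)=\alpha\beta(b)\circ(\alpha(a)\circ c)-(\beta(b)\circ\alpha(a))\circ\beta(c)$. BiHom-pre-Lie bimodule $(M,\circ_\ell,\circ_r,\alpha_M,\beta_M)$ over it: linear $\circ_\ell:A\otimes M\to M$, $\circ_r:M\otimes A\to M$, commuting linear $\alpha_M,\beta_M$ with $f_M(a\circ_\ell m)=f_A(a)\circ_\ell f_M(m)$, $f_M(m\circ_r a)=f_M(m)\circ_r f_A(a)$ for $f\in\{\alpha,\beta\}$, and $\alpha_A\beta_A(a)\circ_\ell(\alpha_A(b)\circ_\ell m)-(\beta_A(a)\circ\alpha_A(b))\circ_\ell\beta_M(m)=\alpha_A\beta_A(b)\circ_\ell(\alpha_A(a)\circ_\ell m)-(\beta_A(b)\circ\alpha_A(a))\circ_\ell\beta_M(m)$, $\alpha_A\beta_A(a)\circ_\ell(\alpha_M(m)\circ_r c)-(\beta_A(a)\circ_\ell\alpha_M(m))\circ_r\beta_A(c)=\alpha_M\beta_M(m)\circ_r(\alpha_A(a)\circ c)-(\beta_M(m)\circ_r\alpha_A(a))\circ_r\beta_A(c)$ for all $a,b,c\in A$, $m\in M$. *)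

theory Defs
  imports "HOL-Analysis.Product_Vector"
begin

(* Algebras and bimodules are whole types, with scalar multiplication by the field 'k as an
   explicit parameter, as in HOL.Vector_Spaces.  A linear map out of U (x) V is given as a
   (curried) bilinear map U => V => W. *)

definition bilinear_map ::
    "('k::field \<Rightarrow> 'u::ab_group_add \<Rightarrow> 'u) \<Rightarrow> ('k \<Rightarrow> 'v::ab_group_add \<Rightarrow> 'v) \<Rightarrow>
     ('k \<Rightarrow> 'w::ab_group_add \<Rightarrow> 'w) \<Rightarrow> ('u \<Rightarrow> 'v \<Rightarrow> 'w) \<Rightarrow> bool"
  where "bilinear_map s1 s2 s3 h \<longleftrightarrow>
    (\<forall>x. Vector_Spaces.linear s2 s3 (\<lambda>y. h x y)) \<and>
    (\<forall>y. Vector_Spaces.linear s1 s3 (\<lambda>x. h x y))"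

locale bihom_pre_lie_algebra = vector_space scale
  for scale :: "'k::field \<Rightarrow> 'a::ab_group_add \<Rightarrow> 'a" +
  fixes mult :: "'a \<Rightarrow> 'a \<Rightarrow> 'a" (infixl \<open>\<odot>\<close> 70)
    and \<alpha> \<beta> :: "'a \<Rightarrow> 'a"
  assumes bilinear_mult: "bilinear_map scale scale scale (\<odot>)"
    and linear_alpha: "Vector_Spaces.linear scale scale \<alpha>"
    and linear_beta: "Vector_Spaces.linear scale scale \<beta>"
    and alpha_beta_commute: "\<alpha> (\<beta> a) = \<beta> (\<alpha> a)"
    and alpha_mult: "\<alpha> (a \<odot> b) = \<alpha> a \<odot> \<alpha> b"
    and beta_mult: "\<beta> (a \<odot> b) = \<beta> a \<odot> \<beta> b"
    and bihom_pre_lie: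
      "\<alpha> (\<beta> a) \<odot> (\<alpha> b \<odot> c) - (\<beta> a \<odot> \<alpha> b) \<odot> \<beta> c =
       \<alpha> (\<beta> b) \<odot> (\<alpha> a \<odot> c) - (\<beta> b \<odot> \<alpha> a) \<odot> \<beta> c"

locale bihom_pre_lie_bimodule =
  A: bihom_pre_lie_algebra scaleA mult \<alpha>\<^sub>A \<beta>\<^sub>A + M: vector_space scaleM
  for scaleA :: "'k::field \<Rightarrow> 'a::ab_group_add \<Rightarrow> 'a"
    and mult :: "'a \<Rightarrow> 'a \<Rightarrow> 'a" (infixl \<open>\<odot>\<close> 70)
    and \<alpha>\<^sub>A \<beta>\<^sub>A :: "'a \<Rightarrow> 'a"
    and scaleM :: "'k \<Rightarrow> 'm::ab_group_add \<Rightarrow> 'm" +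
  fixes lact :: "'a \<Rightarrow> 'm \<Rightarrow> 'm" (infixl \<open>\<odot>\<^sub>l\<close> 70)
    and ract :: "'m \<Rightarrow> 'a \<Rightarrow> 'm" (infixl \<open>\<odot>\<^sub>r\<close> 70)
    and \<alpha>\<^sub>M \<beta>\<^sub>M :: "'m \<Rightarrow> 'm"
  assumes bilinear_lact: "bilinear_map scaleA scaleM scaleM (\<odot>\<^sub>l)"
    and bilinear_ract: "bilinear_map scaleM scaleA scaleM (\<odot>\<^sub>r)"
    and linear_alphaM: "Vector_Spaces.linear scaleM scaleM \<alpha>\<^sub>M"
    and linear_betaM: "Vector_Spaces.linear scaleM scaleM \<beta>\<^sub>M"
    and alphaM_betaM_commute: "\<alpha>\<^sub>M (\<beta>\<^sub>M m) = \<beta>\<^sub>M (\<alpha>\<^sub>M m)"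
    and alpha_lact: "\<alpha>\<^sub>M (a \<odot>\<^sub>l m) = \<alpha>\<^sub>A a \<odot>\<^sub>l \<alpha>\<^sub>M m"
    and beta_lact: "\<beta>\<^sub>M (a \<odot>\<^sub>l m) = \<beta>\<^sub>A a \<odot>\<^sub>l \<beta>\<^sub>M m"
    and alpha_ract: "\<alpha>\<^sub>M (m \<odot>\<^sub>r a) = \<alpha>\<^sub>M m \<odot>\<^sub>r \<alpha>\<^sub>A a"
    and beta_ract: "\<beta>\<^sub>M (m \<odot>\<^sub>r a) = \<beta>\<^sub>M m \<odot>\<^sub>r \<beta>\<^sub>A a"
    and bimodule_left:
      "\<alpha>\<^sub>A (\<beta>\<^sub>A a) \<odot>\<^sub>l (\<alpha>\<^sub>A b \<odot>\<^sub>l m) - (\<beta>\<^sub>A a \<odot> \<alpha>\<^sub>A b) \<odot>\<^sub>l \<beta>\<^sub>M m =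
       \<alpha>\<^sub>A (\<beta>\<^sub>A b) \<odot>\<^sub>l (\<alpha>\<^sub>A a \<odot>\<^sub>l m) - (\<beta>\<^sub>A b \<odot> \<alpha>\<^sub>A a) \<odot>\<^sub>l \<beta>\<^sub>M m"
    and bimodule_right:
      "\<alpha>\<^sub>A (\<beta>\<^sub>A a) \<odot>\<^sub>l (\<alpha>\<^sub>M m \<odot>\<^sub>r c) - (\<beta>\<^sub>A a \<odot>\<^sub>l \<alpha>\<^sub>M m) \<odot>\<^sub>r \<beta>\<^sub>A c =
       \<alpha>\<^sub>M (\<beta>\<^sub>M m) \<odot>\<^sub>r (\<alpha>\<^sub>A a \<odot> c) - (\<beta>\<^sub>M m \<odot>\<^sub>r \<alpha>\<^sub>A a) \<odot>\<^sub>r \<beta>\<^sub>A c"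

(* The direct sum of A and M is the product type, a + m being the pair (a, m); its vector space
   structure is module_prod.scale, and the direct sum of two maps is map_prod. *)

definition direct_sum_mult ::
    "('a::ab_group_add \<Rightarrow> 'a \<Rightarrow> 'a) \<Rightarrow> ('a \<Rightarrow> 'm::ab_group_add \<Rightarrow> 'm) \<Rightarrow> ('m \<Rightarrow> 'a \<Rightarrow> 'm) \<Rightarrow>
     'a \<times> 'm \<Rightarrow> 'a \<times> 'm \<Rightarrow> 'a \<times> 'm"
  where "direct_sum_mult mult lact ract =
    (\<lambda>(a, m) (a', m'). (mult a a', lact a m' + ract m a'))"

end

theory Submission
  imports Defs
begin

text \<open>On \<open>A \<oplus> M\<close> the BiHom-pre-Lie identity at \<open>a + m\<close>, \<open>b + n\<close>, \<open>c + p\<close> has as its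
  \<open>A\<close>-component the identity of \<open>A\<close>.  Each term of its \<open>M\<close>-component is linear in \<open>(m, n, p)\<close>: the
  part in \<open>p\<close> is the first bimodule identity, and the parts in \<open>n\<close> and \<open>m\<close> are the second one, for
  \<open>(a, n, c)\<close> and for \<open>(b, m, c)\<close> with the sides exchanged.  Conversely, each bimodule identity is
  obtained by putting exactly one argument in \<open>M\<close> and the others in \<open>A\<close>.\<close>

lemma linear_iff_add_scale:
  assumes "vector_space s1" and "vector_space s2"
  shows "Vector_Spaces.linear s1 s2 f \<longleftrightarrow>
    (\<forall>x y. f (x + y) = f x + f y) \<and> (\<forall>r x. f (s1 r x) = s2 r (f x))"
  using assms
  by (simp add: Vector_Spaces.linear_def module_hom_def module_hom_axioms_def
      vector_space_def module_def)

lemma bilinear_map_iff: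
  assumes "vector_space s1" and "vector_space s2" and "vector_space s3"
  shows "bilinear_map s1 s2 s3 h \<longleftrightarrow>
    (\<forall>x y z. h x (y + z) = h x y + h x z) \<and> (\<forall>r x y. h x (s2 r y) = s3 r (h x y)) \<and>
    (\<forall>x y z. h (x + y) z = h x z + h y z) \<and> (\<forall>r x y. h (s1 r x) y = s3 r (h x y))"
  using assms by (auto simp: bilinear_map_def linear_iff_add_scale)

lemma bilinear_map_zero:
  assumes "bilinear_map s1 s2 s3 h"
  shows "h x 0 = 0" and "h 0 y = 0"
proof -
  interpret R: Vector_Spaces.linear s2 s3 "h x"
    using assms by (simp add: bilinear_map_def)
  interpret L: Vector_Spaces.linear s1 s3 "\<lambda>x. h x y"
    using assms by (simp add: bilinear_map_def)
  show "h x 0 = 0" by (rule R.zero)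
  show "h 0 y = 0" by (rule L.zero)
qed

lemma vector_space_module_prod:
  assumes "vector_space s1" and "vector_space s2"
  shows "vector_space (module_prod.scale s1 s2)"
proof -
  interpret vector_space_prod s1 s2
    using assms by (simp add: vector_space_prod_def vector_space_pair_def)
  show ?thesis by unfold_locales
qed

lemma module_prod_scale_apply:
  assumes "vector_space s1" and "vector_space s2"
  shows "module_prod.scale s1 s2 r (x, y) = (s1 r x, s2 r y)"
proof -
  interpret vector_space_prod s1 s2
    using assms by (simp add: vector_space_prod_def vector_space_pair_def)
  show ?thesis by (simp add: scale_def)
qed

lemma linear_map_prod:
  assumes "Vector_Spaces.linear s1 t1 f" and "Vector_Spaces.linear s2 t2 g"
  shows "Vector_Spaces.linear (module_prod.scale s1 s2) (module_prod.scale t1 t2) (map_prod f g)"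
proof -
  have vs: "vector_space s1" "vector_space t1" "vector_space s2" "vector_space t2"
    using assms by (simp_all add: Vector_Spaces.linear_def)
  show ?thesis
    using assms vs
    by (auto simp: linear_iff_add_scale vector_space_module_prod module_prod_scale_apply)
qed

lemma direct_sum_mult_apply [simp]:
  "direct_sum_mult mult lact ract (a, m) (a', m') = (mult a a', lact a m' + ract m a')"
  by (simp add: direct_sum_mult_def)

lemma bilinear_map_direct_sum_mult:
  assumes "vector_space scaleA" and "vector_space scaleM"
    and "bilinear_map scaleA scaleA scaleA mult"
    and "bilinear_map scaleA scaleM scaleM lact"
    and "bilinear_map scaleM scaleA scaleM ract"
  shows "bilinear_map (module_prod.scale scaleA scaleM) (module_prod.scale scaleA scaleM)
    (module_prod.scale scaleA scaleM) (direct_sum_mult mult lact ract)"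
proof -
  interpret M: vector_space scaleM by (fact assms(2))
  show ?thesis
    using assms
    by (simp add: bilinear_map_iff vector_space_module_prod module_prod_scale_apply
        M.scale_right_distrib)
qed

lemma (in bihom_pre_lie_bimodule) bihom_pre_lie_algebra_direct_sum:
  "bihom_pre_lie_algebra (module_prod.scale scaleA scaleM) (direct_sum_mult (\<odot>) (\<odot>\<^sub>l) (\<odot>\<^sub>r))
    (map_prod \<alpha>\<^sub>A \<alpha>\<^sub>M) (map_prod \<beta>\<^sub>A \<beta>\<^sub>M)"
proof -
  note vs = A.vector_space_axioms M.vector_space_axioms
  have add_simps: "\<And>a m n. a \<odot>\<^sub>l (m + n) = a \<odot>\<^sub>l m + a \<odot>\<^sub>l n"
    "\<And>m n a. (m + n) \<odot>\<^sub>r a = m \<odot>\<^sub>r a + n \<odot>\<^sub>r a"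
    "\<And>m n. \<alpha>\<^sub>M (m + n) = \<alpha>\<^sub>M m + \<alpha>\<^sub>M n" "\<And>m n. \<beta>\<^sub>M (m + n) = \<beta>\<^sub>M m + \<beta>\<^sub>M n"
    using bilinear_lact bilinear_ract linear_alphaM linear_betaM vs
    by (simp_all add: bilinear_map_iff linear_iff_add_scale)
  have pre_lie_M:
    "\<alpha>\<^sub>A (\<beta>\<^sub>A a) \<odot>\<^sub>l (\<alpha>\<^sub>A b \<odot>\<^sub>l p + \<alpha>\<^sub>M n \<odot>\<^sub>r c) + \<alpha>\<^sub>M (\<beta>\<^sub>M m) \<odot>\<^sub>r (\<alpha>\<^sub>A b \<odot> c)
       - ((\<beta>\<^sub>A a \<odot> \<alpha>\<^sub>A b) \<odot>\<^sub>l \<beta>\<^sub>M p + (\<beta>\<^sub>A a \<odot>\<^sub>l \<alpha>\<^sub>M n + \<beta>\<^sub>M m \<odot>\<^sub>r \<alpha>\<^sub>A b) \<odot>\<^sub>r \<beta>\<^sub>A c) =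
     \<alpha>\<^sub>A (\<beta>\<^sub>A b) \<odot>\<^sub>l (\<alpha>\<^sub>A a \<odot>\<^sub>l p + \<alpha>\<^sub>M m \<odot>\<^sub>r c) + \<alpha>\<^sub>M (\<beta>\<^sub>M n) \<odot>\<^sub>r (\<alpha>\<^sub>A a \<odot> c)
       - ((\<beta>\<^sub>A b \<odot> \<alpha>\<^sub>A a) \<odot>\<^sub>l \<beta>\<^sub>M p + (\<beta>\<^sub>A b \<odot>\<^sub>l \<alpha>\<^sub>M m + \<beta>\<^sub>M n \<odot>\<^sub>r \<alpha>\<^sub>A a) \<odot>\<^sub>r \<beta>\<^sub>A c)"
    for a b c m n p
    using arg_cong2[where f = "(+)", OF bimodule_left[of a b p]
        arg_cong2[where f = "(-)", OF bimodule_right[of a n c] bimodule_right[of b m c]]]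
    by (simp add: add_simps algebra_simps)
  show ?thesis
  proof (intro bihom_pre_lie_algebra.intro bihom_pre_lie_algebra_axioms.intro)
    show "vector_space (module_prod.scale scaleA scaleM)"
      by (rule vector_space_module_prod[OF vs])
    show "bilinear_map (module_prod.scale scaleA scaleM) (module_prod.scale scaleA scaleM)
        (module_prod.scale scaleA scaleM) (direct_sum_mult (\<odot>) (\<odot>\<^sub>l) (\<odot>\<^sub>r))"
      by (rule bilinear_map_direct_sum_mult[OF vs A.bilinear_mult bilinear_lact bilinear_ract])
  qed (auto simp: linear_map_prod A.linear_alpha A.linear_beta linear_alphaM linear_betaM
      A.alpha_beta_commute alphaM_betaM_commute A.alpha_mult A.beta_mult add_simps
      alpha_lact alpha_ract beta_lact beta_ract
      A.bihom_pre_lie[unfolded A.alpha_beta_commute]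
      pre_lie_M[unfolded A.alpha_beta_commute alphaM_betaM_commute, unfolded add_simps])
qed

theorem proposition2p38:
  fixes scaleA :: "'k::field \<Rightarrow> 'a::ab_group_add \<Rightarrow> 'a"
    and mult :: "'a \<Rightarrow> 'a \<Rightarrow> 'a"
    and \<alpha>\<^sub>A \<beta>\<^sub>A :: "'a \<Rightarrow> 'a"
    and scaleM :: "'k \<Rightarrow> 'm::ab_group_add \<Rightarrow> 'm"
    and lact :: "'a \<Rightarrow> 'm \<Rightarrow> 'm"
    and ract :: "'m \<Rightarrow> 'a \<Rightarrow> 'm"
    and \<alpha>\<^sub>M \<beta>\<^sub>M :: "'m \<Rightarrow> 'm"
  assumes "bihom_pre_lie_algebra scaleA mult \<alpha>\<^sub>A \<beta>\<^sub>A"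
    and "vector_space scaleM"
    and "bilinear_map scaleA scaleM scaleM lact"
    and "bilinear_map scaleM scaleA scaleM ract"
    and "Vector_Spaces.linear scaleM scaleM \<alpha>\<^sub>M"
    and "Vector_Spaces.linear scaleM scaleM \<beta>\<^sub>M"
    and "\<alpha>\<^sub>M \<circ> \<beta>\<^sub>M = \<beta>\<^sub>M \<circ> \<alpha>\<^sub>M"
  shows "bihom_pre_lie_algebra (module_prod.scale scaleA scaleM) (direct_sum_mult mult lact ract)
           (map_prod \<alpha>\<^sub>A \<alpha>\<^sub>M) (map_prod \<beta>\<^sub>A \<beta>\<^sub>M)
         \<longleftrightarrow> bihom_pre_lie_bimodule scaleA mult \<alpha>\<^sub>A \<beta>\<^sub>A scaleM lact ract \<alpha>\<^sub>M \<beta>\<^sub>M"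
proof
  interpret A: bihom_pre_lie_algebra scaleA mult \<alpha>\<^sub>A \<beta>\<^sub>A by (fact assms(1))
  note zero_simps = bilinear_map_zero[OF assms(3)] bilinear_map_zero[OF assms(4)]
    bilinear_map_zero[OF A.bilinear_mult] module_hom.zero[OF Vector_Spaces.linear.axioms(3)[OF A.linear_alpha]]
    module_hom.zero[OF Vector_Spaces.linear.axioms(3)[OF A.linear_beta]]
    module_hom.zero[OF Vector_Spaces.linear.axioms(3)[OF assms(5)]]
    module_hom.zero[OF Vector_Spaces.linear.axioms(3)[OF assms(6)]]
  assume "bihom_pre_lie_algebra (module_prod.scale scaleA scaleM) (direct_sum_mult mult lact ract)
    (map_prod \<alpha>\<^sub>A \<alpha>\<^sub>M) (map_prod \<beta>\<^sub>A \<beta>\<^sub>M)"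
  then interpret AM: bihom_pre_lie_algebra "module_prod.scale scaleA scaleM"
    "direct_sum_mult mult lact ract" "map_prod \<alpha>\<^sub>A \<alpha>\<^sub>M" "map_prod \<beta>\<^sub>A \<beta>\<^sub>M" .
  show "bihom_pre_lie_bimodule scaleA mult \<alpha>\<^sub>A \<beta>\<^sub>A scaleM lact ract \<alpha>\<^sub>M \<beta>\<^sub>M"
  proof (intro bihom_pre_lie_bimodule.intro bihom_pre_lie_bimodule_axioms.intro)
    fix a b c :: 'a and m :: 'm
    show "\<alpha>\<^sub>M (\<beta>\<^sub>M m) = \<beta>\<^sub>M (\<alpha>\<^sub>M m)"
      using assms(7) by (rule comp_eq_dest)
    show "\<alpha>\<^sub>M (lact a m) = lact (\<alpha>\<^sub>A a) (\<alpha>\<^sub>M m)"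
      using AM.alpha_mult[of "(a, 0)" "(0, m)"] by (simp add: zero_simps)
    show "\<beta>\<^sub>M (lact a m) = lact (\<beta>\<^sub>A a) (\<beta>\<^sub>M m)"
      using AM.beta_mult[of "(a, 0)" "(0, m)"] by (simp add: zero_simps)
    show "\<alpha>\<^sub>M (ract m a) = ract (\<alpha>\<^sub>M m) (\<alpha>\<^sub>A a)"
      using AM.alpha_mult[of "(0, m)" "(a, 0)"] by (simp add: zero_simps)
    show "\<beta>\<^sub>M (ract m a) = ract (\<beta>\<^sub>M m) (\<beta>\<^sub>A a)"
      using AM.beta_mult[of "(0, m)" "(a, 0)"] by (simp add: zero_simps)
    show "lact (\<alpha>\<^sub>A (\<beta>\<^sub>A a)) (lact (\<alpha>\<^sub>A b) m) - lact (mult (\<beta>\<^sub>A a) (\<alpha>\<^sub>A b)) (\<beta>\<^sub>M m) =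
        lact (\<alpha>\<^sub>A (\<beta>\<^sub>A b)) (lact (\<alpha>\<^sub>A a) m) - lact (mult (\<beta>\<^sub>A b) (\<alpha>\<^sub>A a)) (\<beta>\<^sub>M m)"
      using AM.bihom_pre_lie[of "(a, 0)" "(b, 0)" "(0, m)"] by (simp add: zero_simps)
    show "lact (\<alpha>\<^sub>A (\<beta>\<^sub>A a)) (ract (\<alpha>\<^sub>M m) c) - ract (lact (\<beta>\<^sub>A a) (\<alpha>\<^sub>M m)) (\<beta>\<^sub>A c) =
        ract (\<alpha>\<^sub>M (\<beta>\<^sub>M m)) (mult (\<alpha>\<^sub>A a) c) - ract (ract (\<beta>\<^sub>M m) (\<alpha>\<^sub>A a)) (\<beta>\<^sub>A c)"
      using AM.bihom_pre_lie[of "(a, 0)" "(0, m)" "(c, 0)"] by (simp add: zero_simps)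
  qed (use assms in simp_all)
next
  assume "bihom_pre_lie_bimodule scaleA mult \<alpha>\<^sub>A \<beta>\<^sub>A scaleM lact ract \<alpha>\<^sub>M \<beta>\<^sub>M"
  then show "bihom_pre_lie_algebra (module_prod.scale scaleA scaleM)
      (direct_sum_mult mult lact ract) (map_prod \<alpha>\<^sub>A \<alpha>\<^sub>M) (map_prod \<beta>\<^sub>A \<beta>\<^sub>M)"
    by (rule bihom_pre_lie_bimodule.bihom_pre_lie_algebra_direct_sum)
qed

end
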